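(* Let $H$ be a $2$-vertex-connected graph on $n$ vertices. Suppose there is a vertex $v\in V(H)$ such that $H_{\mathrm{asym}}:=H-v$ is rigid (its only automorphism is the identity) and the following condition $( * )$ holds: $( * )$ Let $v^1,\dots,v^k$ be the vertices of $H$ with $H-v^i\cong H-v\cong H_{\mathrm{asym}}$ for all $i\in[k]$. If $k\ge 2$, then every $w\in V(H)$ lies in the same automorphism orbit of $H_{\mathrm{asym}}$ regardless of which of the vertices $v^i\neq w$ has been removed. Equivalently: for every $w\in V(H)$ and all $i,j\in[k]$ with $v^i\neq w\neq v^j$, there is an isomorphism $H-v^i\to H-v^j$ mapping $w$ to $w$. Then $H$ is reconstructible from its $(n-1)$-graphlet degree distribution. That is, every graph $H'$ on $n$ vertices whose $(n-1)$-graphlet degree distribution equals that of $H$ (for suitable orderings of the vertex sets) is isomorphic to $H$.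
   Context: All graphs are finite, simple and undirected. Let $H$ be a graph on $n$ vertices. A graphlet is a pair $(G,r)$ where $G$ is a connected graph with at least one and fewer than $n$ vertices, and $r\in V(G)$ is its root. Two graphlets $(G,r)$ and $(G',r')$ are isomorphic if some isomorphism $G\to G'$ maps $r$ to $r'$. Graphlets are considered up to this isomorphism, in a fixed enumeration of the isomorphism classes. For $v\in V(H)$ and a graphlet $(G,r)$, the graphlet degree of $v$ is the number of vertex sets $S\subseteq V(H)$ with $v\in S$ such that some isomorphism from the induced subgraph $H[S]$ onto $G$ maps $v$ to $r$. The $m$-graphlet degree sequence ($m$-gds) of $v$ is the vector of graphlet degrees of $v$ over all graphlet classes with exactly $m$ vertices. The $(\le m)$-gds of $v$ is the same vector over all graphlet classes with at most $m$ vertices. The $m$-graphlet degree distribution ($m$-gdd), respectively the $(\le m)$-gdd, of $H$ is the matrix whose rows are the $m$-gds, respectively $(\le m)$-gds, of the vertices of $H$. Rows are indexed by an ordering of $V(H)$ and columns by graphlet classes. *)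

theory Defs
  imports Main "HOL-Library.FuncSet"
begin

record 'a sgraph =
  gverts :: "'a set"
  gedges :: "'a set set"

definition simple_graph :: "'a sgraph \<Rightarrow> bool" where
  "simple_graph G \<longleftrightarrow>
     finite (gverts G) \<and> (\<forall>e\<in>gedges G. e \<subseteq> gverts G \<and> card e = 2)"

definition graph_iso :: "('a \<Rightarrow> 'b) \<Rightarrow> 'a sgraph \<Rightarrow> 'b sgraph \<Rightarrow> bool" where
  "graph_iso f G G' \<longleftrightarrow>
     bij_betw f (gverts G) (gverts G') \<and>
     (\<forall>x\<in>gverts G. \<forall>y\<in>gverts G. {x, y} \<in> gedges G \<longleftrightarrow> {f x, f y} \<in> gedges G')"

definition isomorphic :: "'a sgraph \<Rightarrow> 'b sgraph \<Rightarrow> bool" where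
  "isomorphic G G' \<longleftrightarrow> (\<exists>f. graph_iso f G G')"

text \<open>Maps are total functions, so an automorphism is compared with the identity on the
  vertex set only.\<close>

definition rigid :: "'a sgraph \<Rightarrow> bool" where
  "rigid G \<longleftrightarrow> (\<forall>f. graph_iso f G G \<longrightarrow> (\<forall>x\<in>gverts G. f x = x))"

definition induced_sgraph :: "'a sgraph \<Rightarrow> 'a set \<Rightarrow> 'a sgraph" where
  "induced_sgraph G S =
     \<lparr>gverts = gverts G \<inter> S, gedges = {e \<in> gedges G. e \<subseteq> S}\<rparr>"

definition del_verts :: "'a sgraph \<Rightarrow> 'a set \<Rightarrow> 'a sgraph" where
  "del_verts G X = induced_sgraph G (gverts G - X)"

abbreviation del_vert :: "'a sgraph \<Rightarrow> 'a \<Rightarrow> 'a sgraph" where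
  "del_vert G v \<equiv> del_verts G {v}"

definition connected_graph :: "'a sgraph \<Rightarrow> bool" where
  "connected_graph G \<longleftrightarrow>
     gverts G \<noteq> {} \<and>
     (\<forall>x\<in>gverts G. \<forall>y\<in>gverts G. (x, y) \<in> {(a, b). {a, b} \<in> gedges G}\<^sup>*)"

text \<open>The usual convention: more than \<open>k\<close> vertices are required, so the complete graph on
  two vertices is not 2-vertex-connected.\<close>

definition vertex_connected :: "nat \<Rightarrow> 'a sgraph \<Rightarrow> bool" where
  "vertex_connected k G \<longleftrightarrow>
     k < card (gverts G) \<and>
     (\<forall>X \<subseteq> gverts G. card X < k \<longrightarrow> connected_graph (del_verts G X))"

text \<open>Vertices of graphlets are natural numbers; every finite rooted graph is isomorphic to
  one of these, so no isomorphism class is lost.\<close>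

definition graphlets :: "nat \<Rightarrow> (nat sgraph \<times> nat) set" where
  "graphlets n = {(G, r). simple_graph G \<and> connected_graph G \<and>
     1 \<le> card (gverts G) \<and> card (gverts G) < n \<and> r \<in> gverts G}"

definition graphlet_rel :: "nat \<Rightarrow> ((nat sgraph \<times> nat) \<times> (nat sgraph \<times> nat)) set" where
  "graphlet_rel n = {((G, r), (G', r')).
     (G, r) \<in> graphlets n \<and> (G', r') \<in> graphlets n \<and> (\<exists>f. graph_iso f G G' \<and> f r = r')}"

definition graphlet_classes :: "nat \<Rightarrow> nat \<Rightarrow> (nat sgraph \<times> nat) set set" where
  "graphlet_classes n m =
     {C \<in> graphlets n // graphlet_rel n. \<forall>(G, r)\<in>C. card (gverts G) = m}"

definition graphlet_degree :: "'a sgraph \<Rightarrow> 'a \<Rightarrow> 'b sgraph \<times> 'b \<Rightarrow> nat" where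
  "graphlet_degree H v = (\<lambda>(G, r).
     card {S. S \<subseteq> gverts H \<and> v \<in> S \<and> (\<exists>f. graph_iso f (induced_sgraph H S) G \<and> f v = r)})"

text \<open>The \<open>m\<close>-graphlet degree sequence of \<open>v\<close>, a vector whose entries are indexed by the
  isomorphism classes themselves. The degree depends only on the class of a
  graphlet, so it is read off at a chosen representative.\<close>

definition gds :: "nat \<Rightarrow> 'a sgraph \<Rightarrow> 'a \<Rightarrow> (nat sgraph \<times> nat) set \<Rightarrow> nat" where
  "gds m H v =
     (\<lambda>C \<in> graphlet_classes (card (gverts H)) m. graphlet_degree H v (SOME g. g \<in> C))"

definition vertex_ordering :: "'a sgraph \<Rightarrow> 'a list \<Rightarrow> bool" where
  "vertex_ordering H vs \<longleftrightarrow> distinct vs \<and> set vs = gverts H"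

text \<open>The \<open>m\<close>-graphlet degree distribution as the list of its rows, with respect to the
  ordering \<open>vs\<close> of the vertex set.\<close>

definition gdd :: "nat \<Rightarrow> 'a sgraph \<Rightarrow> 'a list \<Rightarrow> ((nat sgraph \<times> nat) set \<Rightarrow> nat) list" where
  "gdd m H vs = map (gds m H) vs"

definition same_gdd :: "nat \<Rightarrow> 'a sgraph \<Rightarrow> 'b sgraph \<Rightarrow> bool" where
  "same_gdd m H H' \<longleftrightarrow>
     (\<exists>vs vs'. vertex_ordering H vs \<and> vertex_ordering H' vs' \<and> gdd m H vs = gdd m H' vs')"

definition iso_deletions :: "'a sgraph \<Rightarrow> 'a \<Rightarrow> 'a set" where
  "iso_deletions H v = {u \<in> gverts H. isomorphic (del_vert H u) (del_vert H v)}"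

text \<open>The set \<open>iso_deletions H v\<close> consists of the vertices \<open>v\<^sup>1, \<dots>, v\<^sup>k\<close>. If there are at
  least two of them, the position of every vertex \<open>w\<close> in \<open>H - v\<close>, up to automorphism, must not depend
  on which of the \<open>v\<^sup>i \<noteq> w\<close> is deleted; this is expressed by isomorphisms fixing \<open>w\<close>.\<close>

definition orbit_condition :: "'a sgraph \<Rightarrow> 'a \<Rightarrow> bool" where
  "orbit_condition H v \<longleftrightarrow>
     (2 \<le> card (iso_deletions H v) \<longrightarrow>
       (\<forall>w\<in>gverts H. \<forall>a\<in>iso_deletions H v. \<forall>b\<in>iso_deletions H v.
          a \<noteq> w \<and> w \<noteq> b \<longrightarrow> (\<exists>f. graph_iso f (del_vert H a) (del_vert H b) \<and> f w = w)))"

end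

theory Submission
  imports Defs
begin

text \<open>
  The distribution determines, for every vertex \<open>w\<close> and its partner \<open>\<phi> w\<close>, a matching
  of the connected rooted cards \<open>(H - u, w)\<close> with the connected rooted cards \<open>(H' - u', \<phi> w)\<close>.
  Counting cards shows that all cards of \<open>H'\<close> are connected. Averaging the degree of the root over
  the cards then shows that \<open>\<phi>\<close> preserves degrees, and counting the cards isomorphic to \<open>H - v\<close>
  shows that \<open>H' - \<phi> v\<close> is one of them. Take an isomorphism \<open>g: H' - \<phi> v \<rightarrow> H - v\<close> and
  \<open>w \<noteq> v\<close>. The card of \<open>H\<close> matched with \<open>(H' - \<phi> v, \<phi> w)\<close> and the orbit condition give an
  automorphism of \<open>H - v\<close> mapping \<open>w\<close> to \<open>g (\<phi> w)\<close>, so \<open>g (\<phi> w) = w\<close> by rigidity. Thus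
  \<open>\<phi>\<close> is an isomorphism away from \<open>v\<close>, and the degrees decide which vertices are adjacent to \<open>v\<close>.
\<close>

section \<open>Isomorphisms and rooted isomorphisms\<close>

lemma graph_iso_id: "graph_iso (\<lambda>x. x) G G"
  by (simp add: graph_iso_def bij_betw_def)

lemma graph_iso_inv:
  assumes "graph_iso f G G'"
  shows "graph_iso (inv_into (gverts G) f) G' G"
proof -
  have b: "bij_betw f (gverts G) (gverts G')" using assms by (simp add: graph_iso_def)
  have b': "bij_betw (inv_into (gverts G) f) (gverts G') (gverts G)"
    using b by (rule bij_betw_inv_into)
  have "{x, y} \<in> gedges G' \<longleftrightarrow> {inv_into (gverts G) f x, inv_into (gverts G) f y} \<in> gedges G"
    if "x \<in> gverts G'" "y \<in> gverts G'" for x y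
  proof -
    let ?g = "inv_into (gverts G) f"
    have "?g x \<in> gverts G" "?g y \<in> gverts G" "f (?g x) = x" "f (?g y) = y"
      using that bij_betwE[OF b'] bij_betw_inv_into_right[OF b] by auto
    then show ?thesis using assms by (auto simp: graph_iso_def)
  qed
  then show ?thesis using b' by (simp add: graph_iso_def)
qed

lemma graph_iso_comp:
  assumes "graph_iso f G G'" "graph_iso g G' G''"
  shows "graph_iso (g \<circ> f) G G''"
  using assms unfolding graph_iso_def
  by (auto intro: bij_betw_trans dest: bij_betwE)

text \<open>The two vertex types are independent, so graphs over \<open>'a\<close>, over
  \<open>'b\<close> and natural-number graphlets can all be compared.\<close>

definition rooted_iso :: "'a sgraph \<Rightarrow> 'a \<Rightarrow> 'b sgraph \<Rightarrow> 'b \<Rightarrow> bool" where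
  "rooted_iso G r G' r' \<longleftrightarrow> (\<exists>f. graph_iso f G G' \<and> f r = r')"

lemma rooted_iso_refl: "rooted_iso G r G r"
  unfolding rooted_iso_def using graph_iso_id by fastforce

text \<open>The map is controlled only on \<open>gverts G\<close>; membership of the root is what
  makes \<open>inv_into\<close> return \<open>r\<close> at \<open>r'\<close>.\<close>

lemma rooted_iso_sym:
  assumes "rooted_iso G r G' r'" "r \<in> gverts G"
  shows "rooted_iso G' r' G r"
proof -
  obtain f where f: "graph_iso f G G'" "f r = r'" using assms by (auto simp: rooted_iso_def)
  then have "inv_into (gverts G) f r' = r"
    using assms(2) by (auto simp: graph_iso_def bij_betw_def)
  then show ?thesis using graph_iso_inv[OF f(1)] by (auto simp: rooted_iso_def)
qed

lemma rooted_iso_trans: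
  assumes "rooted_iso G r G' r'" "rooted_iso G' r' G'' r''"
  shows "rooted_iso G r G'' r''"
  using assms graph_iso_comp unfolding rooted_iso_def by fastforce

lemma rooted_iso_isomorphic: "rooted_iso G r G' r' \<Longrightarrow> isomorphic G G'"
  by (auto simp: rooted_iso_def isomorphic_def)

lemma isomorphic_sym: "isomorphic G G' \<Longrightarrow> isomorphic G' G"
  using graph_iso_inv unfolding isomorphic_def by blast

lemma isomorphic_trans: "isomorphic G G' \<Longrightarrow> isomorphic G' G'' \<Longrightarrow> isomorphic G G''"
  using graph_iso_comp unfolding isomorphic_def by blast

lemma isomorphic_card: "isomorphic G G' \<Longrightarrow> card (gverts G) = card (gverts G')"
  unfolding isomorphic_def graph_iso_def using bij_betw_same_card by blast

text \<open>Paths are carried over edge by edge. Simplicity of \<open>G\<close> keeps every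
  intermediate vertex in \<open>gverts G\<close>, where the isomorphism is known to preserve
  edges.\<close>

lemma isomorphic_connected_graph:
  assumes "isomorphic G G'" "simple_graph G" "connected_graph G"
  shows "connected_graph G'"
proof -
  obtain f where f: "graph_iso f G G'" using assms(1) by (auto simp: isomorphic_def)
  let ?R = "{(a, b). {a, b} \<in> gedges G}" and ?R' = "{(a, b). {a, b} \<in> gedges G'}"
  have img: "f ` gverts G = gverts G'" using f by (auto simp: graph_iso_def bij_betw_def)
  have path: "(x, y) \<in> ?R\<^sup>* \<Longrightarrow> x \<in> gverts G \<Longrightarrow> y \<in> gverts G \<and> (f x, f y) \<in> ?R'\<^sup>*" for x y
  proof (induction rule: rtrancl_induct)
    case base then show ?case by simp
  next
    case (step y z)
    then have e: "{y, z} \<in> gedges G" by simp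
    then have "z \<in> gverts G" using assms(2) by (auto simp: simple_graph_def)
    moreover have "(f y, f z) \<in> ?R'"
      using f e step \<open>z \<in> gverts G\<close> by (auto simp: graph_iso_def)
    ultimately show ?case using step by (meson rtrancl.rtrancl_into_rtrancl)
  qed
  show ?thesis
    unfolding connected_graph_def
  proof (intro conjI ballI)
    show "gverts G' \<noteq> {}" using assms(3) img by (auto simp: connected_graph_def)
    fix x' y' assume "x' \<in> gverts G'" "y' \<in> gverts G'"
    then obtain x y where xy: "x \<in> gverts G" "x' = f x" "y \<in> gverts G" "y' = f y"
      using img by blast
    then have "(x, y) \<in> ?R\<^sup>*" using assms(3) unfolding connected_graph_def by blast
    then show "(x', y') \<in> ?R'\<^sup>*" using path xy by blast
  qed
qed

section \<open>Graphlet types of rooted graphs, and graphlet degrees as counts of cards\<close>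

lemma simple_graph_nat_copy:
  assumes "simple_graph G"
  obtains f and N :: "nat sgraph" where "simple_graph N" "graph_iso f G N"
proof -
  obtain f :: "'a \<Rightarrow> nat" where inj: "inj_on f (gverts G)"
    using assms finite_imp_inj_to_nat_seg unfolding simple_graph_def by metis
  define N where "N = \<lparr>gverts = f ` gverts G, gedges = (`) f ` gedges G\<rparr>"
  have sub: "e \<subseteq> gverts G" if "e \<in> gedges G" for e
    using assms that by (auto simp: simple_graph_def)
  have "card (f ` e) = 2" if "e \<in> gedges G" for e
    using assms that card_image[OF inj_on_subset[OF inj sub[OF that]]]
    by (auto simp: simple_graph_def)
  then have "simple_graph N"
    using assms sub unfolding simple_graph_def N_def by auto
  moreover have "{x, y} \<in> gedges G \<longleftrightarrow> {f x, f y} \<in> gedges N"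
    if "x \<in> gverts G" "y \<in> gverts G" for x y
  proof
    show "{x, y} \<in> gedges G \<Longrightarrow> {f x, f y} \<in> gedges N"
      using imageI[of "{x, y}" "gedges G" "(`) f"] by (simp add: N_def)
    assume "{f x, f y} \<in> gedges N"
    then obtain e where e: "e \<in> gedges G" "f ` {x, y} = f ` e" by (auto simp: N_def)
    then have "{x, y} = e"
      using inj_on_image_eq_iff[OF inj, of "{x, y}" e] sub that by auto
    then show "{x, y} \<in> gedges G" using e by simp
  qed
  then have "graph_iso f G N"
    using inj by (simp add: graph_iso_def bij_betw_def N_def)
  ultimately show ?thesis using that by blast
qed

lemma gverts_del_vert [simp]: "gverts (del_vert G u) = gverts G - {u}"
  by (auto simp: del_verts_def induced_sgraph_def)

lemma gedges_del_vert: "gedges (del_vert G u) = {e \<in> gedges G. e \<subseteq> gverts G - {u}}"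
  by (simp add: del_verts_def induced_sgraph_def)

lemma simple_graph_del_vert: "simple_graph G \<Longrightarrow> simple_graph (del_vert G u)"
  by (auto simp: simple_graph_def gedges_del_vert)

text \<open>Consisting of natural-number graphlets, types of rooted graphs over different vertex
  types are comparable, and also comparable with the columns of the distribution. The type is empty
  when \<open>G\<close> is disconnected.\<close>

definition graphlet_type :: "nat \<Rightarrow> 'a sgraph \<Rightarrow> 'a \<Rightarrow> (nat sgraph \<times> nat) set" where
  "graphlet_type n G r = {(N, s) \<in> graphlets n. rooted_iso G r N s}"

lemma graphlet_rel_iff:
  "((G, r), (G', r')) \<in> graphlet_rel n \<longleftrightarrow>
    (G, r) \<in> graphlets n \<and> (G', r') \<in> graphlets n \<and> rooted_iso G r G' r'"
  by (simp add: graphlet_rel_def rooted_iso_def)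

text \<open>A natural-number copy of \<open>G\<close> gives a representative, and the type is the
  \<open>graphlet_rel\<close> class of that representative.\<close>

lemma graphlet_type_in_classes:
  assumes "simple_graph G" "connected_graph G" "r \<in> gverts G" "card (gverts G) = m" "m < n"
  shows "graphlet_type n G r \<in> graphlet_classes n m"
proof -
  obtain f and N :: "nat sgraph" where N: "simple_graph N" "graph_iso f G N"
    using simple_graph_nat_copy[OF assms(1)] .
  have iso: "isomorphic G N" using N by (auto simp: isomorphic_def)
  have r: "rooted_iso G r N (f r)" using N by (auto simp: rooted_iso_def)
  have fr: "f r \<in> gverts N" using N assms(3) by (auto simp: graph_iso_def dest: bij_betwE)
  have "0 < card (gverts N)" using N fr by (auto simp: simple_graph_def card_gt_0_iff)
  then have gr: "(N, f r) \<in> graphlets n"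
    using N fr isomorphic_card[OF iso] isomorphic_connected_graph[OF iso] assms
    by (auto simp: graphlets_def)
  have "graphlet_type n G r = graphlet_rel n `` {(N, f r)}"
    using gr r rooted_iso_sym[OF r assms(3)]
    by (auto simp: graphlet_type_def graphlet_rel_iff intro: rooted_iso_trans)
  then have "graphlet_type n G r \<in> graphlets n // graphlet_rel n"
    using gr by (simp add: quotientI)
  moreover have "\<forall>(N, s)\<in>graphlet_type n G r. card (gverts N) = m"
    using assms(4) by (auto simp: graphlet_type_def dest!: rooted_iso_isomorphic isomorphic_card)
  ultimately show ?thesis by (simp add: graphlet_classes_def)
qed

lemma graphlet_classes_nonempty:
  assumes "C \<in> graphlet_classes n m"
  shows "C \<noteq> {}"
proof -
  obtain N s where "(N, s) \<in> graphlets n" "C = graphlet_rel n `` {(N, s)}"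
    using assms by (auto simp: graphlet_classes_def elim!: quotientE)
  then have "(N, s) \<in> C" by (simp add: graphlet_rel_iff rooted_iso_refl)
  then show ?thesis by blast
qed

text \<open>Turns the test against one representative, as in \<open>graphlet_degree\<close>, into an
  equality of types, so the choice made by \<open>SOME\<close> does not matter.\<close>

lemma rooted_iso_iff_graphlet_type:
  assumes "C \<in> graphlet_classes n m" "(N, s) \<in> C" "r \<in> gverts G"
  shows "rooted_iso G r N s \<longleftrightarrow> graphlet_type n G r = C"
proof
  assume r: "rooted_iso G r N s"
  obtain M t where M: "(M, t) \<in> graphlets n" "C = graphlet_rel n `` {(M, t)}"
    using assms(1) by (auto simp: graphlet_classes_def elim!: quotientE)
  then have "rooted_iso M t N s" "t \<in> gverts M" "s \<in> gverts N"
    using assms(2) by (auto simp: graphlet_rel_iff graphlets_def)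
  then have 1: "rooted_iso M t G r" "rooted_iso G r M t"
    using r assms(3) by (meson rooted_iso_sym rooted_iso_trans)+
  show "graphlet_type n G r = C"
    using M 1 by (auto simp: graphlet_type_def graphlet_rel_iff intro: rooted_iso_trans)
next
  assume "graphlet_type n G r = C"
  then show "rooted_iso G r N s" using assms(2) by (auto simp: graphlet_type_def)
qed

text \<open>A set of \<open>n - 1\<close> vertices containing \<open>w\<close> is the complement of
  exactly one vertex \<open>u\<close> different from \<open>w\<close>, so counting such sets is
  counting cards rooted at \<open>w\<close>.\<close>

lemma graphlet_degree_eq_card_deletions:
  assumes "C \<in> graphlet_classes n (n - 1)" "finite (gverts H)" "card (gverts H) = n" "w \<in> gverts H"
  shows "graphlet_degree H w (SOME g. g \<in> C) =
    card {u \<in> gverts H - {w}. graphlet_type n (del_vert H u) w = C}"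
proof -
  let ?V = "gverts H"
  obtain N s where Ns: "(SOME g. g \<in> C) = (N, s)" by (rule prod.exhaust)
  then have NC: "(N, s) \<in> C"
    using graphlet_classes_nonempty[OF assms(1)] by (metis some_in_eq)
  then have cN: "card (gverts N) = n - 1" using assms(1) by (auto simp: graphlet_classes_def)
  have n: "0 < n" using assms by (auto simp: card_gt_0_iff)
  have type: "rooted_iso (del_vert H u) w N s \<longleftrightarrow> graphlet_type n (del_vert H u) w = C"
    if "u \<in> ?V - {w}" for u
    using that assms(4) by (intro rooted_iso_iff_graphlet_type[OF assms(1) NC]) auto
  have "{S. S \<subseteq> ?V \<and> w \<in> S \<and> rooted_iso (induced_sgraph H S) w N s} =
    (\<lambda>u. ?V - {u}) ` {u \<in> ?V - {w}. graphlet_type n (del_vert H u) w = C}" (is "?A = ?g ` ?B")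
  proof
    show "?A \<subseteq> ?g ` ?B"
    proof
      fix S assume S: "S \<in> ?A"
      then have "card (gverts (induced_sgraph H S)) = n - 1"
        using cN isomorphic_card[OF rooted_iso_isomorphic, of "induced_sgraph H S" w N s] by simp
      moreover have "gverts (induced_sgraph H S) = S" using S by (auto simp: induced_sgraph_def)
      ultimately have "card (?V - S) = 1"
        using S assms(2,3) n card_Diff_subset[of S ?V] finite_subset[of S ?V] by simp
      then obtain u where u: "?V - S = {u}" by (auto simp: card_1_singleton_iff)
      then have Su: "S = ?V - {u}" "u \<in> ?V - {w}" using S by auto
      moreover have "rooted_iso (del_vert H u) w N s" using S Su by (simp add: del_verts_def)
      ultimately show "S \<in> ?g ` ?B" using type by blast
    qed
    show "?g ` ?B \<subseteq> ?A"
      using type assms(4) by (auto simp: del_verts_def)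
  qed
  moreover have "inj_on ?g ?B" by (auto simp: inj_on_def)
  ultimately show ?thesis
    unfolding graphlet_degree_def Ns by (simp add: card_image flip: rooted_iso_def)
qed

section \<open>Matching the rooted cards of graphs with equal distributions\<close>

lemma bij_betw_of_equal_fibres:
  assumes "finite X" "finite Y"
    and "\<And>c. c \<in> k ` X \<union> l ` Y \<Longrightarrow> card {x \<in> X. k x = c} = card {y \<in> Y. l y = c}"
  obtains h where "bij_betw h X Y" "\<And>x. x \<in> X \<Longrightarrow> l (h x) = k x"
proof -
  have "\<exists>g. bij_betw g {x \<in> X. k x = c} {y \<in> Y. l y = c}" if "c \<in> k ` X \<union> l ` Y" for c
    using assms that by (intro finite_same_card_bij) auto
  then obtain g where g: "\<And>c. c \<in> k ` X \<union> l ` Y \<Longrightarrow>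
      bij_betw (g c) {x \<in> X. k x = c} {y \<in> Y. l y = c}"
    by metis
  \<comment> \<open>The fibrewise bijections are glued: each \<open>x\<close> uses the one belonging
    to its own value \<open>k x\<close>.\<close>
  define h where "h = (\<lambda>x. g (k x) x)"
  have h: "h x \<in> Y \<and> l (h x) = k x" if "x \<in> X" for x
    using bij_betwE[OF g[of "k x"]] that unfolding h_def by blast
  have inj: "inj_on h X"
  proof (rule inj_onI)
    fix x y assume xy: "x \<in> X" "y \<in> X" "h x = h y"
    then have "k x = k y" using h by metis
    then show "x = y"
      using bij_betw_imp_inj_on[OF g[of "k x"]] xy unfolding h_def inj_on_def by simp
  qed
  have "Y \<subseteq> h ` X"
  proof
    fix y assume "y \<in> Y"
    then have "y \<in> g (l y) ` {x \<in> X. k x = l y}"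
      using bij_betw_imp_surj_on[OF g[of "l y"]] by blast
    then obtain x where "x \<in> X" "k x = l y" "y = g (l y) x" by blast
    then have "y = h x" by (simp add: h_def)
    then show "y \<in> h ` X" using \<open>x \<in> X\<close> by (rule image_eqI)
  qed
  then have "bij_betw h X Y" using inj h by (auto simp: bij_betw_def)
  then show ?thesis using that h by blast
qed

text \<open>Graphlets are connected, so these are the only cards rooted at \<open>w\<close> that the
  distribution sees.\<close>

definition connected_deletions :: "'a sgraph \<Rightarrow> 'a \<Rightarrow> 'a set" where
  "connected_deletions H w = {u \<in> gverts H - {w}. connected_graph (del_vert H u)}"

lemma graphlet_type_deletion_in_classes:
  assumes "simple_graph H" "card (gverts H) = n" "w \<in> gverts H" "u \<in> connected_deletions H w"
  shows "graphlet_type n (del_vert H u) w \<in> graphlet_classes n (n - 1)"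
proof -
  have "0 < n" using assms by (auto simp: simple_graph_def card_gt_0_iff)
  then show ?thesis
    using assms
    by (intro graphlet_type_in_classes simple_graph_del_vert) (auto simp: connected_deletions_def)
qed

text \<open>A graphlet class is nonempty with connected members, so a card of type \<open>C\<close>
  is automatically connected and the restriction to connected deletions loses nothing.\<close>

lemma card_connected_deletions_of_type:
  assumes "simple_graph H" "card (gverts H) = n" "w \<in> gverts H" "C \<in> graphlet_classes n (n - 1)"
  shows "card {u \<in> connected_deletions H w. graphlet_type n (del_vert H u) w = C} =
    gds (n - 1) H w C"
proof -
  have "connected_graph (del_vert H u)"
    if u: "u \<in> gverts H - {w}" "graphlet_type n (del_vert H u) w = C" for u
  proof -
    obtain N s where "(N, s) \<in> graphlet_type n (del_vert H u) w"
      using u graphlet_classes_nonempty[OF assms(4)] by auto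
    then have "simple_graph N" "connected_graph N" "isomorphic (del_vert H u) N"
      by (auto simp: graphlet_type_def graphlets_def dest: rooted_iso_isomorphic)
    then show ?thesis using isomorphic_sym isomorphic_connected_graph by blast
  qed
  then have "{u \<in> connected_deletions H w. graphlet_type n (del_vert H u) w = C} =
      {u \<in> gverts H - {w}. graphlet_type n (del_vert H u) w = C}"
    by (auto simp: connected_deletions_def)
  then show ?thesis
    using graphlet_degree_eq_card_deletions[OF assms(4) _ assms(2,3)] assms
    by (simp add: gds_def simple_graph_def)
qed

text \<open>Equal rows give, for each type, equally many connected cards at \<open>w\<close> and at
  \<open>\<phi> w\<close>; a bijection on each fibre then matches cards of equal type. The matching
  \<open>h\<close> may vary with \<open>w\<close>.\<close>

lemma same_gdd_imp_deletions_matching: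
  assumes "simple_graph H" "card (gverts H) = n" "simple_graph H'" "card (gverts H') = n"
    and "same_gdd (n - 1) H H'"
  obtains \<phi> where "bij_betw \<phi> (gverts H) (gverts H')"
    and "\<And>w. w \<in> gverts H \<Longrightarrow> \<exists>h. bij_betw h (connected_deletions H w) (connected_deletions H' (\<phi> w)) \<and>
      (\<forall>u\<in>connected_deletions H w. rooted_iso (del_vert H u) w (del_vert H' (h u)) (\<phi> w))"
proof -
  obtain vs vs' where vs: "distinct vs" "set vs = gverts H" "distinct vs'" "set vs' = gverts H'"
    and eq: "map (gds (n - 1) H) vs = map (gds (n - 1) H') vs'"
    using assms(5) by (auto simp: same_gdd_def vertex_ordering_def gdd_def)
  have len: "length vs' = length vs" using eq by (metis length_map)
  \<comment> \<open>Vertices at the same position of the two orderings have equal rows.\<close>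
  define \<phi> where "\<phi> = (!) vs' \<circ> inv_into {..<length vs} ((!) vs)"
  have nth: "bij_betw ((!) vs) {..<length vs} (gverts H)"
    using vs by (intro bij_betw_nth) auto
  have nth': "bij_betw ((!) vs') {..<length vs} (gverts H')"
    using vs len by (intro bij_betw_nth) auto
  have bij: "bij_betw \<phi> (gverts H) (gverts H')"
    unfolding \<phi>_def using bij_betw_trans[OF bij_betw_inv_into[OF nth] nth'] .
  have gds: "gds (n - 1) H w = gds (n - 1) H' (\<phi> w)" if w: "w \<in> gverts H" for w
  proof -
    obtain i where i: "i < length vs" "w = vs ! i"
      using w vs(2) by (metis in_set_conv_nth)
    then have "\<phi> w = vs' ! i"
      using bij_betw_inv_into_left[OF nth] by (simp add: \<phi>_def)
    then show ?thesis using eq i len by (metis nth_map)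
  qed
  have "\<exists>h. bij_betw h (connected_deletions H w) (connected_deletions H' (\<phi> w)) \<and>
      (\<forall>u\<in>connected_deletions H w. rooted_iso (del_vert H u) w (del_vert H' (h u)) (\<phi> w))"
    if w: "w \<in> gverts H" for w
  proof -
    let ?X = "connected_deletions H w" and ?Y = "connected_deletions H' (\<phi> w)"
    let ?k = "\<lambda>u. graphlet_type n (del_vert H u) w"
    let ?l = "\<lambda>u. graphlet_type n (del_vert H' u) (\<phi> w)"
    have w': "\<phi> w \<in> gverts H'" using bij w by (auto dest: bij_betwE)
    have fin: "finite ?X" "finite ?Y"
      using assms by (auto simp: connected_deletions_def simple_graph_def)
    have card: "card {u \<in> ?X. ?k u = c} = card {u \<in> ?Y. ?l u = c}" if "c \<in> ?k ` ?X \<union> ?l ` ?Y" for c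
    proof -
      \<comment> \<open>Entries of \<open>gds\<close> are degrees only at indices in
        \<open>graphlet_classes\<close>; every type that occurs is such an index.\<close>
      have "c \<in> graphlet_classes n (n - 1)"
        using that graphlet_type_deletion_in_classes[OF assms(1,2) w]
          graphlet_type_deletion_in_classes[OF assms(3,4) w'] by auto
      then show ?thesis
        using card_connected_deletions_of_type[OF assms(1,2) w]
          card_connected_deletions_of_type[OF assms(3,4) w'] gds[OF w] by simp
    qed
    obtain h where h: "bij_betw h ?X ?Y" "\<And>u. u \<in> ?X \<Longrightarrow> ?l (h u) = ?k u"
      by (rule bij_betw_of_equal_fibres[OF fin card]) blast+
    have "rooted_iso (del_vert H u) w (del_vert H' (h u)) (\<phi> w)" if u: "u \<in> ?X" for u
    proof -
      \<comment> \<open>Equality of two empty types would say nothing; nonemptiness supplies a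
        common graphlet through which the isomorphisms compose.\<close>
      have "?k u \<noteq> {}"
        using graphlet_classes_nonempty[OF graphlet_type_deletion_in_classes[OF assms(1,2) w u]] .
      then obtain N s where "(N, s) \<in> ?k u" "(N, s) \<in> ?l (h u)" using h(2)[OF u] by auto
      then have "rooted_iso (del_vert H u) w N s" "rooted_iso (del_vert H' (h u)) (\<phi> w) N s"
        by (auto simp: graphlet_type_def)
      moreover have "\<phi> w \<in> gverts (del_vert H' (h u))"
        using bij_betwE[OF h(1)] u w' by (auto simp: connected_deletions_def)
      ultimately show ?thesis by (meson rooted_iso_sym rooted_iso_trans)
    qed
    then show ?thesis using h by blast
  qed
  then show ?thesis using that bij by blast
qed

section \<open>Vertex degrees in cards, and a counting argument for deletions\<close>

definition vertex_degree :: "'a sgraph \<Rightarrow> 'a \<Rightarrow> nat" where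
  "vertex_degree G x = card {y. {x, y} \<in> gedges G}"

lemma neighbours_subset:
  assumes "simple_graph G"
  shows "{y. {x, y} \<in> gedges G} \<subseteq> gverts G - {x}"
  using assms by (auto simp: simple_graph_def)

lemma finite_neighbours:
  assumes "simple_graph G"
  shows "finite {y. {x, y} \<in> gedges G}"
  using finite_subset[OF neighbours_subset[OF assms]] assms by (simp add: simple_graph_def)

lemma vertex_degree_rooted_iso:
  assumes "simple_graph G" "simple_graph G'" "rooted_iso G x G' x'" "x \<in> gverts G"
  shows "vertex_degree G x = vertex_degree G' x'"
proof -
  obtain f where f: "graph_iso f G G'" "f x = x'" using assms by (auto simp: rooted_iso_def)
  let ?A = "{y. {x, y} \<in> gedges G}" and ?B = "{y. {x', y} \<in> gedges G'}"
  have sub: "?A \<subseteq> gverts G" "?B \<subseteq> gverts G'"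
    using neighbours_subset[OF assms(1), of x] neighbours_subset[OF assms(2), of x'] by blast+
  have inj: "inj_on f (gverts G)" and im: "f ` gverts G = gverts G'"
    using f by (auto simp: graph_iso_def bij_betw_def)
  have e: "{x, y} \<in> gedges G \<longleftrightarrow> {x', f y} \<in> gedges G'" if "y \<in> gverts G" for y
    using f that assms(4) by (auto simp: graph_iso_def)
  have "f ` ?A = ?B"
  proof
    show "f ` ?A \<subseteq> ?B" using e sub by auto
    show "?B \<subseteq> f ` ?A"
    proof
      fix z assume z: "z \<in> ?B"
      then obtain y where "y \<in> gverts G" "z = f y" using sub im by blast
      then show "z \<in> f ` ?A" using e z by blast
    qed
  qed
  then show ?thesis
    unfolding vertex_degree_def using card_image[OF inj_on_subset[OF inj sub(1)]] by simp
qed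

lemma vertex_degree_del_vert:
  assumes "simple_graph G" "u \<noteq> x" "u \<in> gverts G" "x \<in> gverts G"
  shows "vertex_degree (del_vert G u) x + of_bool ({x, u} \<in> gedges G) = vertex_degree G x"
proof -
  let ?A = "{y. {x, y} \<in> gedges G}"
  have "{y. {x, y} \<in> gedges (del_vert G u)} = ?A - {u}"
    using assms by (auto simp: gedges_del_vert simple_graph_def)
  then show ?thesis
    using finite_neighbours[OF assms(1), of x] card_Suc_Diff1[of ?A u]
    by (simp add: vertex_degree_def)
qed

text \<open>Each neighbour of \<open>x\<close> lowers exactly one summand by one. The additive form
  avoids truncated subtraction.\<close>

lemma sum_vertex_degree_deletions:
  assumes "simple_graph G" "x \<in> gverts G"
  shows "(\<Sum>u\<in>gverts G - {x}. vertex_degree (del_vert G u) x) + vertex_degree G x =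
    (card (gverts G) - 1) * vertex_degree G x"
proof -
  let ?V = "gverts G - {x}"
  have fin: "finite ?V" using assms by (simp add: simple_graph_def)
  have "?V \<inter> {u. {x, u} \<in> gedges G} = {u. {x, u} \<in> gedges G}"
    using neighbours_subset[OF assms(1)] by blast
  then have "(\<Sum>u\<in>?V. of_bool ({x, u} \<in> gedges G)) = vertex_degree G x"
    using fin by (simp add: vertex_degree_def sum_of_bool_eq)
  then have "(\<Sum>u\<in>?V. vertex_degree (del_vert G u) x) + vertex_degree G x =
      (\<Sum>u\<in>?V. vertex_degree (del_vert G u) x + of_bool ({x, u} \<in> gedges G))"
    by (simp add: sum.distrib)
  also have "\<dots> = (\<Sum>u\<in>?V. vertex_degree G x)"
    using assms by (intro sum.cong vertex_degree_del_vert) auto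
  finally show ?thesis using assms(2) by simp
qed

text \<open>If \<open>\<phi> v\<close> were outside \<open>D'\<close>, taking \<open>w = v\<close>
  would give \<open>D'\<close> one element fewer than \<open>D\<close>. Another \<open>w\<close>
  shows that \<open>D'\<close> is nonempty, so it contains some \<open>\<phi> x\<close>. Removing
  that point leaves two fewer than \<open>card D\<close>, but \<open>D - {x}\<close> has lost at
  most one.\<close>

lemma card_eq_diff_singletons_imp_mem:
  assumes "bij_betw \<phi> V V'" "D' \<subseteq> V'" "finite V" "D \<subseteq> V" "v \<in> D" "2 \<le> card V"
    and card: "\<And>w. w \<in> V \<Longrightarrow> card (D - {w}) = card (D' - {\<phi> w})"
  shows "\<phi> v \<in> D'"
proof (rule ccontr)
  assume no: "\<phi> v \<notin> D'"
  have fin: "finite D" "finite D'"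
    using assms bij_betw_finite finite_subset by blast+
  have v: "v \<in> V" using assms by blast
  have D: "Suc (card D') = card D"
    using card[OF v] no fin card_Suc_Diff1[OF fin(1) assms(5)] by simp
  have "V \<noteq> {v}" using assms(6) by auto
  then obtain w where w: "w \<in> V" "w \<noteq> v" using v by blast
  then have "0 < card (D' - {\<phi> w})"
    using card[OF w(1), symmetric] w(2) assms(5) fin by (auto simp: card_gt_0_iff)
  then obtain x' where "x' \<in> D'" by (auto simp: card_gt_0_iff)
  then obtain x where x: "x \<in> V" "\<phi> x \<in> D'"
    using assms(2) bij_betw_imp_surj_on[OF assms(1)] by blast
  then have "Suc (card (D - {x})) = card D'"
    using card[OF x(1)] card_Suc_Diff1[OF fin(2) x(2)] by simp
  moreover have "card D \<le> Suc (card (D - {x}))"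
    using fin card_Suc_Diff1[of D x] by (cases "x \<in> D") auto
  ultimately show False using D by simp
qed

section \<open>Reconstruction from the matched cards\<close>

theorem mainTheorem1:
  fixes H :: "'a sgraph" and v :: 'a and n :: nat
  assumes "simple_graph H"
    and "card (gverts H) = n"
    and "vertex_connected 2 H"
    and "v \<in> gverts H"
    and "rigid (del_vert H v)"
    and "orbit_condition H v"
  shows "\<forall>H' :: 'b sgraph.
    simple_graph H' \<and> card (gverts H') = n \<and> same_gdd (n - 1) H H' \<longrightarrow> isomorphic H H'"
proof (intro allI impI, elim conjE)
  fix H' :: "'b sgraph"
  assume H': "simple_graph H'" "card (gverts H') = n" and same: "same_gdd (n - 1) H H'"
  let ?V = "gverts H" and ?V' = "gverts H'"
  have n: "2 < n" using assms by (simp add: vertex_connected_def)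
  have fin: "finite ?V" "finite ?V'" using assms H' by (auto simp: simple_graph_def)
  obtain \<phi> where \<phi>: "bij_betw \<phi> ?V ?V'"
    and match: "\<And>w. w \<in> ?V \<Longrightarrow> \<exists>h. bij_betw h (connected_deletions H w) (connected_deletions H' (\<phi> w)) \<and>
      (\<forall>u\<in>connected_deletions H w. rooted_iso (del_vert H u) w (del_vert H' (h u)) (\<phi> w))"
    using same_gdd_imp_deletions_matching[OF assms(1,2) H' same] by blast
  have mem: "\<phi> w \<in> ?V'" if "w \<in> ?V" for w using \<phi> that by (auto dest: bij_betwE)
  \<comment> \<open>2-vertex-connectedness, applied to singletons \<open>X\<close>, makes every card
    of \<open>H\<close> connected.\<close>
  have all: "connected_deletions H w = ?V - {w}" for w
    using assms(3) unfolding connected_deletions_def vertex_connected_def by auto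
  have "\<exists>h. bij_betw h (?V - {w}) (?V' - {\<phi> w}) \<and>
      (\<forall>u\<in>?V - {w}. rooted_iso (del_vert H u) w (del_vert H' (h u)) (\<phi> w))"
    if w: "w \<in> ?V" for w
  proof -
    obtain h where h: "bij_betw h (?V - {w}) (connected_deletions H' (\<phi> w))"
      "\<forall>u\<in>?V - {w}. rooted_iso (del_vert H u) w (del_vert H' (h u)) (\<phi> w)"
      using match[OF w] all by auto
    \<comment> \<open>The matched subset of \<open>?V' - {\<phi> w}\<close> already has
      \<open>n - 1\<close> elements, so it is everything.\<close>
    have "card (connected_deletions H' (\<phi> w)) = card (?V' - {\<phi> w})"
      using bij_betw_same_card[OF h(1)] w mem assms(2) H' by simp
    then have "connected_deletions H' (\<phi> w) = ?V' - {\<phi> w}"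
      using fin by (intro card_subset_eq) (auto simp: connected_deletions_def)
    then show ?thesis using h by auto
  qed
  then obtain h where h: "\<And>w. w \<in> ?V \<Longrightarrow> bij_betw (h w) (?V - {w}) (?V' - {\<phi> w})"
    and iso: "\<And>w u. w \<in> ?V \<Longrightarrow> u \<in> ?V - {w} \<Longrightarrow>
      rooted_iso (del_vert H u) w (del_vert H' (h w u)) (\<phi> w)"
    by metis

  have degree: "vertex_degree H w = vertex_degree H' (\<phi> w)" if w: "w \<in> ?V" for w
  proof -
    have "(\<Sum>u\<in>?V - {w}. vertex_degree (del_vert H u) w) =
        (\<Sum>u\<in>?V - {w}. vertex_degree (del_vert H' (h w u)) (\<phi> w))"
      using iso[OF w] assms(1) H'(1) w
      by (intro sum.cong vertex_degree_rooted_iso simple_graph_del_vert) auto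
    also have "\<dots> = (\<Sum>u\<in>?V' - {\<phi> w}. vertex_degree (del_vert H' u) (\<phi> w))"
      using sum.reindex_bij_betw[OF h[OF w]] .
    finally obtain s where "s + vertex_degree H w = (n - 1) * vertex_degree H w"
      "s + vertex_degree H' (\<phi> w) = (n - 1) * vertex_degree H' (\<phi> w)"
      using sum_vertex_degree_deletions[OF assms(1) w]
        sum_vertex_degree_deletions[OF H'(1) mem[OF w]] assms(2) H'(2) by metis
    \<comment> \<open>As \<open>n > 2\<close>, one copy of the degree cancels and the positive
      factor \<open>Suc k = n - 2\<close> remains.\<close>
    moreover obtain k where "n - 1 = Suc (Suc k)" using n
      by (auto dest!: less_imp_Suc_add)
    ultimately have "Suc k * vertex_degree H w = Suc k * vertex_degree H' (\<phi> w)" by simp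
    then show ?thesis by (simp only: Suc_mult_cancel1)
  qed

  define D where "D = iso_deletions H v"
  \<comment> \<open>Cards of both graphs are compared with the same \<open>H - v\<close>, so that
    \<open>h w\<close> maps \<open>D - {w}\<close> onto \<open>D' - {\<phi> w}\<close>.\<close>
  define D' where "D' = {u \<in> ?V'. isomorphic (del_vert H' u) (del_vert H v)}"
  have "\<phi> v \<in> D'"
  proof (rule card_eq_diff_singletons_imp_mem[OF \<phi>])
    show "D' \<subseteq> ?V'" "finite ?V" "D \<subseteq> ?V" "2 \<le> card ?V"
      using fin n assms(2) by (auto simp: D_def D'_def iso_deletions_def)
    show "v \<in> D" using assms(4) graph_iso_id by (auto simp: D_def iso_deletions_def isomorphic_def)
    show "card (D - {w}) = card (D' - {\<phi> w})" if w: "w \<in> ?V" for w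
    proof -
      have D_iff: "u \<in> D \<longleftrightarrow> h w u \<in> D'" if u: "u \<in> ?V - {w}" for u
      proof -
        have "isomorphic (del_vert H u) (del_vert H' (h w u))"
          using rooted_iso_isomorphic[OF iso[OF w u]] .
        then have "isomorphic (del_vert H u) (del_vert H v) \<longleftrightarrow>
            isomorphic (del_vert H' (h w u)) (del_vert H v)"
          by (metis isomorphic_sym isomorphic_trans)
        then show ?thesis
          using bij_betwE[OF h[OF w]] u by (simp add: D_def D'_def iso_deletions_def)
      qed
      have sub: "D - {w} \<subseteq> ?V - {w}" "D' - {\<phi> w} \<subseteq> ?V' - {\<phi> w}"
        by (auto simp: D_def D'_def iso_deletions_def)
      have "h w ` (D - {w}) = D' - {\<phi> w}"
      proof
        show "h w ` (D - {w}) \<subseteq> D' - {\<phi> w}"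
          using bij_betwE[OF h[OF w]] D_iff sub(1) by auto
        show "D' - {\<phi> w} \<subseteq> h w ` (D - {w})"
        proof
          fix x assume x: "x \<in> D' - {\<phi> w}"
          then obtain u where u: "u \<in> ?V - {w}" "x = h w u"
            using sub(2) bij_betw_imp_surj_on[OF h[OF w]] by blast
          then show "x \<in> h w ` (D - {w})" using D_iff[OF u(1)] x by blast
        qed
      qed
      moreover have "inj_on (h w) (D - {w})"
        using bij_betw_imp_inj_on[OF h[OF w]]
        using sub(1) by (rule inj_on_subset)
      ultimately show ?thesis using card_image by metis
    qed
  qed
  then obtain g where g: "graph_iso g (del_vert H' (\<phi> v)) (del_vert H v)"
    by (auto simp: D'_def isomorphic_def)

  have g\<phi>: "g (\<phi> w) = w" if w: "w \<in> ?V" "w \<noteq> v" for w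
  proof -
    have neq: "\<phi> v \<noteq> \<phi> w" using \<phi> w assms(4) by (auto simp: bij_betw_def inj_on_def)
    then have "\<phi> v \<in> h w ` (?V - {w})"
      using bij_betw_imp_surj_on[OF h[OF w(1)]] mem[OF assms(4)] by simp
    \<comment> \<open>The card matched with \<open>H' - \<phi> v\<close> depends on the root
      \<open>w\<close>, and \<open>u\<close> need not be \<open>v\<close>; the orbit condition
      bridges this gap.\<close>
    then obtain u where u: "u \<in> ?V - {w}" "h w u = \<phi> v" by (metis imageE)
    have r: "rooted_iso (del_vert H u) w (del_vert H' (\<phi> v)) (\<phi> w)"
      using iso[OF w(1) u(1)] u(2) by simp
    also have "rooted_iso (del_vert H' (\<phi> v)) (\<phi> w) (del_vert H v) (g (\<phi> w))"
      using g by (auto simp: rooted_iso_def)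
    finally (rooted_iso_trans) have uv: "rooted_iso (del_vert H u) w (del_vert H v) (g (\<phi> w))" .
    have uD: "u \<in> D" "v \<in> D"
      using rooted_iso_isomorphic[OF uv] u assms(4) graph_iso_id
      by (auto simp: D_def iso_deletions_def isomorphic_def)
    have "rooted_iso (del_vert H v) w (del_vert H u) w"
    \<comment> \<open>The orbit condition applies only when \<open>D\<close> has two elements;
      distinct \<open>u\<close> and \<open>v\<close> supply them, both different from
      \<open>w\<close>.\<close>
    proof (cases "u = v")
      case True then show ?thesis by (simp add: rooted_iso_refl)
    next
      case False
      have "finite D" using fin by (simp add: D_def iso_deletions_def)
      then have "2 \<le> card D"
        using False uD card_mono[of D "{u, v}"] by simp
      then show ?thesis
        using assms(6) uD u(1) w unfolding orbit_condition_def D_def rooted_iso_def by auto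
    qed
    \<comment> \<open>This is an automorphism of \<open>H - v\<close> sending \<open>w\<close> to
      \<open>g (\<phi> w)\<close>, which rigidity forces to fix \<open>w\<close>.\<close>
    then have "rooted_iso (del_vert H v) w (del_vert H v) (g (\<phi> w))"
      using uv by (rule rooted_iso_trans)
    then show ?thesis using assms(5) w unfolding rigid_def rooted_iso_def by auto
  qed

  have away: "{x, y} \<in> gedges H \<longleftrightarrow> {\<phi> x, \<phi> y} \<in> gedges H'"
    if "x \<in> ?V - {v}" "y \<in> ?V - {v}" for x y
  proof -
    have "\<phi> x \<in> ?V' - {\<phi> v}" "\<phi> y \<in> ?V' - {\<phi> v}"
      using \<phi> that assms(4) mem by (auto simp: bij_betw_def inj_on_def)
    then show ?thesis
      using g g\<phi> that unfolding graph_iso_def gverts_del_vert by (auto simp: gedges_del_vert)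
  qed
  \<comment> \<open>Degrees agree in the whole graphs and in the cards without \<open>v\<close> and
    \<open>\<phi> v\<close>; the difference is the adjacency bit.\<close>
  have at: "{x, v} \<in> gedges H \<longleftrightarrow> {\<phi> x, \<phi> v} \<in> gedges H'" if x: "x \<in> ?V - {v}" for x
  proof -
    have x': "\<phi> x \<in> ?V' - {\<phi> v}"
      using \<phi> x assms(4) mem by (auto simp: bij_betw_def inj_on_def)
    have "rooted_iso (del_vert H' (\<phi> v)) (\<phi> x) (del_vert H v) x"
      using g g\<phi> x by (auto simp: rooted_iso_def)
    then have "vertex_degree (del_vert H' (\<phi> v)) (\<phi> x) = vertex_degree (del_vert H v) x"
      using x' assms(1) H'(1) by (intro vertex_degree_rooted_iso simple_graph_del_vert) auto
    moreover have "vertex_degree (del_vert H v) x + of_bool ({x, v} \<in> gedges H) = vertex_degree H x"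
      using x assms(1,4) by (intro vertex_degree_del_vert) auto
    moreover have "vertex_degree (del_vert H' (\<phi> v)) (\<phi> x) + of_bool ({\<phi> x, \<phi> v} \<in> gedges H') =
        vertex_degree H' (\<phi> x)"
      using x' H'(1) mem[OF assms(4)] by (intro vertex_degree_del_vert) auto
    moreover have "vertex_degree H x = vertex_degree H' (\<phi> x)" using degree x by simp
    ultimately have "(of_bool ({x, v} \<in> gedges H) :: nat) = of_bool ({\<phi> x, \<phi> v} \<in> gedges H')"
      by linarith
    then show ?thesis by (simp only: of_bool_eq_iff)
  qed
  have "{x, y} \<in> gedges H \<longleftrightarrow> {\<phi> x, \<phi> y} \<in> gedges H'" if "x \<in> ?V" "y \<in> ?V" for x y
  proof -
    consider "x = y" | "x \<noteq> v" "y \<noteq> v" | "x \<noteq> v" "y = v" | "x = v" "y \<noteq> v" by blast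
    then show ?thesis
    proof cases
      case 1
      then show ?thesis using assms(1) H'(1) by (auto simp: simple_graph_def)
    next
      case 4
      then show ?thesis using at[of y] that by (simp add: insert_commute)
    qed (use away at that in auto)
  qed
  then show "isomorphic H H'" using \<phi> by (auto simp: isomorphic_def graph_iso_def)
qed

end
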